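(* Let $S$ be a recurrent specular set on the finite alphabet $A$ (so $A\subset S$). For any $w\in S$ such that $w\neq w^{-1}$, the set of complete return words to $\{w,w^{-1}\}$ in $S$ has $\mathrm{Card}(A)$ elements.
   Context: Words are over a finite alphabet $A$; $\varepsilon$ is the empty word. A set $S$ of words on $A$ is factorial if it contains $A$ and all the factors of its elements. For $w\in S$ let $L(w)=\{a\in A\mid aw\in S\}$, $R(w)=\{a\in A\mid wa\in S\}$, $B(w)=\{(a,b)\in A\times A\mid awb\in S\}$. A factorial set $S$ is biextendable if $B(w)\neq\emptyset$ for all $w\in S$. The extension graph $\mathcal{E}(w)$ is the undirected graph whose vertex set is the disjoint union of $L(w)$ and $R(w)$ and whose edges are the pairs in $B(w)$. A biextendable set $S$ is a tree set of characteristic $c$ if $\mathcal{E}(w)$ is a tree for every nonempty $w\in S$ and $\mathcal{E}(\varepsilon)$ is a disjoint union of $c$ trees. Let $\theta$ be an involution on $A$ (possibly with fixed points) and let $G_\theta$ be the group generated by $A$ with relations $a\theta(a)=1$, $a\in A$ (so $a^{-1}=\theta(a)$). A word is reduced if it has no factor $a\theta(a)$ with $a\in A$; the inverse $w^{-1}$ of a reduced word $w=a_1\cdots a_n$ is the reduced word $\theta(a_n)\cdots\theta(a_1)$. A laminary set on $A$ relative to $\theta$ is a biextendable set of reduced words closed under taking inverses. A specular set is a laminary set which is a tree set of characteristic $2$. A set $S\ne\{\varepsilon\}$ is recurrent if it is factorial and for all $u,w\in S$ there is $v\in S$ with $uvw\in S$. For a set $X\subset S$ of nonempty words, a complete return word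 to $X$ is a word of $S$ with a proper prefix in $X$, a proper suffix in $X$ but no internal factor in $X$ ($v$ is an internal factor of $y$ if $y=uvw$ with $u,w$ nonempty). *)

theory Defs
  imports "HOL-Library.Sublist" "Graph_Theory.Digraph_Component"
begin

text \<open>
  An undirected graph is a symmetric digraph without parallel arcs. The library predicate
  \<open>Digraph_Component.tree\<close> cannot be used here: it forbids all directed cycles, and in a
  symmetric digraph each edge already gives the directed cycle \<open>u \<rightarrow> v \<rightarrow> u\<close> of length two.
  The cycles of the undirected graph are the directed cycles of length one (loops) and of
  length at least three. Connected graphs have at least one vertex.
\<close>

definition undirected_tree :: "'v pair_pre_digraph \<Rightarrow> bool" where
  "undirected_tree G \<longleftrightarrow>
     pair_sym_digraph G \<and>
     Digraph_Component.connected (with_proj G) \<and>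
     \<not> (\<exists>p. pre_digraph.cycle (with_proj G) p \<and> length p \<noteq> 2)"

definition disjoint_union_of_trees :: "nat \<Rightarrow> 'v pair_pre_digraph \<Rightarrow> bool" where
  "disjoint_union_of_trees c G \<longleftrightarrow>
     (\<exists>\<T>. finite \<T> \<and> card \<T> = c \<and>
          (\<forall>T\<in>\<T>. undirected_tree T) \<and>
          (\<forall>T\<in>\<T>. \<forall>T'\<in>\<T>. T \<noteq> T' \<longrightarrow> pverts T \<inter> pverts T' = {}) \<and>
          pverts G = (\<Union>T\<in>\<T>. pverts T) \<and>
          parcs G = (\<Union>T\<in>\<T>. parcs T))"

definition factorial_set :: "'a set \<Rightarrow> 'a list set \<Rightarrow> bool" where
  "factorial_set A S \<longleftrightarrow>
     S \<subseteq> lists A \<and> (\<forall>a\<in>A. [a] \<in> S) \<and> (\<forall>w\<in>S. \<forall>v. sublist v w \<longrightarrow> v \<in> S)"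

definition left_ext :: "'a set \<Rightarrow> 'a list set \<Rightarrow> 'a list \<Rightarrow> 'a set" where
  "left_ext A S w = {a \<in> A. a # w \<in> S}"

definition right_ext :: "'a set \<Rightarrow> 'a list set \<Rightarrow> 'a list \<Rightarrow> 'a set" where
  "right_ext A S w = {a \<in> A. w @ [a] \<in> S}"

definition bi_ext :: "'a set \<Rightarrow> 'a list set \<Rightarrow> 'a list \<Rightarrow> ('a \<times> 'a) set" where
  "bi_ext A S w = {(a, b) \<in> A \<times> A. a # w @ [b] \<in> S}"

definition biextendable :: "'a set \<Rightarrow> 'a list set \<Rightarrow> bool" where
  "biextendable A S \<longleftrightarrow> factorial_set A S \<and> (\<forall>w\<in>S. bi_ext A S w \<noteq> {})"

definition extension_graph :: "'a set \<Rightarrow> 'a list set \<Rightarrow> 'a list \<Rightarrow> ('a + 'a) pair_pre_digraph" where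
  "extension_graph A S w =
     \<lparr> pverts = left_ext A S w <+> right_ext A S w,
       parcs = (\<Union>(a, b) \<in> bi_ext A S w. {(Inl a, Inr b), (Inr b, Inl a)}) \<rparr>"

definition tree_set :: "'a set \<Rightarrow> nat \<Rightarrow> 'a list set \<Rightarrow> bool" where
  "tree_set A c S \<longleftrightarrow>
     biextendable A S \<and>
     (\<forall>w\<in>S. w \<noteq> [] \<longrightarrow> undirected_tree (extension_graph A S w)) \<and>
     disjoint_union_of_trees c (extension_graph A S [])"

definition recurrent :: "'a set \<Rightarrow> 'a list set \<Rightarrow> bool" where
  "recurrent A S \<longleftrightarrow>
     S \<noteq> {[]} \<and> factorial_set A S \<and> (\<forall>u\<in>S. \<forall>w\<in>S. \<exists>v\<in>S. u @ v @ w \<in> S)"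

definition involution_on :: "'a set \<Rightarrow> ('a \<Rightarrow> 'a) \<Rightarrow> bool" where
  "involution_on A \<theta> \<longleftrightarrow> (\<forall>a\<in>A. \<theta> a \<in> A \<and> \<theta> (\<theta> a) = a)"

definition reduced :: "'a set \<Rightarrow> ('a \<Rightarrow> 'a) \<Rightarrow> 'a list \<Rightarrow> bool" where
  "reduced A \<theta> w \<longleftrightarrow> \<not> (\<exists>a\<in>A. sublist [a, \<theta> a] w)"

definition inv_word :: "('a \<Rightarrow> 'a) \<Rightarrow> 'a list \<Rightarrow> 'a list" where
  "inv_word \<theta> w = map \<theta> (rev w)"

definition laminary :: "'a set \<Rightarrow> ('a \<Rightarrow> 'a) \<Rightarrow> 'a list set \<Rightarrow> bool" where
  "laminary A \<theta> S \<longleftrightarrow>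
     biextendable A S \<and> (\<forall>w\<in>S. reduced A \<theta> w) \<and> (\<forall>w\<in>S. inv_word \<theta> w \<in> S)"

definition specular :: "'a set \<Rightarrow> ('a \<Rightarrow> 'a) \<Rightarrow> 'a list set \<Rightarrow> bool" where
  "specular A \<theta> S \<longleftrightarrow> laminary A \<theta> S \<and> tree_set A 2 S"

definition internal_factor :: "'a list \<Rightarrow> 'a list \<Rightarrow> bool" where
  "internal_factor v y \<longleftrightarrow> (\<exists>u w. u \<noteq> [] \<and> w \<noteq> [] \<and> y = u @ v @ w)"

definition complete_return_words :: "'a list set \<Rightarrow> 'a list set \<Rightarrow> 'a list set" where
  "complete_return_words S X =
     {y \<in> S. (\<exists>x\<in>X. strict_prefix x y) \<and> (\<exists>x\<in>X. strict_suffix x y) \<and>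
             \<not> (\<exists>x\<in>X. internal_factor x y)}"

end

theory Submission
  imports Defs
begin

text \<open>
  Counting the edges of the extension graphs shows that the excess \<open>Card(R(y)) - 1\<close> of a
  nonempty word \<open>y\<close> is the sum of the excesses of its left extensions \<open>ay\<close>, while the letters
  have total excess \<open>Card(A) - c\<close>. Let \<open>X\<close> be a nonempty set of words of the same positive
  length. The words of \<open>S\<close> in which \<open>X\<close> occurs only as a prefix are the inner nodes of a forest
  with roots \<open>X\<close>, whose leaves are the complete return words to \<open>X\<close>; so the number of leaves is
  \<open>Card(X)\<close> plus the total excess of the inner nodes. The inner nodes also arise by reading
  words to the left until \<open>X\<close> occurs for the first time, so by additivity their total excess is
  \<open>Card(A) - c\<close>. Truncating this count at length \<open>k\<close> bounds the number of complete return words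
  independently of \<open>k\<close>; so there are finitely many, and by recurrence any word which avoids \<open>X\<close>,
  or in which \<open>X\<close> is only a prefix, is shorter than some complete return word. Hence the count
  is exact for large \<open>k\<close>.
\<close>

section \<open>Counting the edges of trees\<close>

lemma rtrancl_leaves_set:
  assumes "(a, b) \<in> E\<^sup>*" "a \<in> W" "b \<notin> W"
  obtains x y where "(x, y) \<in> E" "x \<in> W" "y \<notin> W"
proof -
  have "b \<in> W \<or> (\<exists>x y. (x, y) \<in> E \<and> x \<in> W \<and> y \<notin> W)"
    using assms(1,2) by (induction rule: rtrancl_induct) auto
  with assms(3) that show ?thesis by blast
qed

text \<open>Distinct \<open>x\<close> and \<open>x'\<close> would be joined by a simple path inside
  \<open>W\<close>; closing it through \<open>y\<close>, which lies outside \<open>W\<close>, gives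
  a cycle of length at least three.\<close>

lemma undirected_tree_unique_neighbour:
  assumes T: "undirected_tree T" and W: "W \<subseteq> pverts T" and y: "y \<notin> W"
    and conn: "(x, x') \<in> (parcs T \<inter> W \<times> W)\<^sup>*"
    and x: "x \<in> W" "(x, y) \<in> parcs T" and x': "x' \<in> W" "(x', y) \<in> parcs T"
  shows "x = x'"
proof (rule ccontr)
  assume ne: "x \<noteq> x'"
  interpret T: pair_sym_digraph T using T by (simp add: undirected_tree_def)
  \<comment> \<open>Taking the path in the induced subgraph \<open>H\<close> keeps its vertices in
    \<open>W\<close>, away from \<open>y\<close>.\<close>
  define H where "H = \<lparr>pverts = W, parcs = parcs T \<inter> W \<times> W\<rparr>"
  interpret H: pair_wf_digraph H by unfold_locales (auto simp: H_def)
  have "(x, x') \<in> (parcs H)\<^sup>+"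
    using conn ne by (auto simp: H_def dest: rtranclD)
  then obtain p where p: "H.apath x p x'"
    using H.reachable1_reachable[of x x'] H.reachable_apath[of x x'] by blast
  let ?q = "(y, x) # p @ [(x', y)]"
  have cas: "pcas u (p @ [(x', y)]) y" if "pcas u p x'" for u
    using that by (induction p arbitrary: u) auto
  have verts: "pawalk_verts u (p @ [(x', y)]) = pawalk_verts u p @ [y]" if "pcas u p x'" for u
    using that by (induction p arbitrary: u) auto
  have pcas: "pcas x p x'" and sub: "set p \<subseteq> parcs H" and dist: "distinct (pawalk_verts x p)"
    using p by (auto simp: H.apath_def H.awalk_def)
  have "set (pawalk_verts x p) \<subseteq> W"
    using p unfolding H.apath_def H.awalk_conv by (simp add: H_def)
  with dist y have "distinct (pawalk_verts x (p @ [(x', y)]))"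
    by (auto simp: verts[OF pcas])
  moreover have "T.awalk y ?q y"
    using T.in_arcsD2[OF x(2)] T.arcs_symmetric[OF x(2)] x'(2) sub cas[OF pcas]
    by (auto simp: T.awalk_def H_def)
  ultimately have "T.cycle ?q"
    by (auto simp: T.cycle_def)
  moreover have "length ?q \<noteq> 2"
    using pcas ne by (cases p) auto
  ultimately show False
    using T by (auto simp: undirected_tree_def)
qed

lemma undirected_tree_no_loop:
  assumes "undirected_tree T"
  shows "(y, y) \<notin> parcs T"
proof
  assume l: "(y, y) \<in> parcs T"
  interpret T: pair_sym_digraph T using assms by (simp add: undirected_tree_def)
  have "T.cycle [(y, y)]"
    using l T.in_arcsD1[OF l] by (auto simp: T.cycle_def T.awalk_def)
  with assms show False by (auto simp: undirected_tree_def)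
qed

text \<open>Connectedness is defined through the symmetric closure, which adds nothing to arcs that
  are already symmetric.\<close>

lemma undirected_tree_reachable:
  assumes "undirected_tree T" "a \<in> pverts T" "b \<in> pverts T"
  shows "(a, b) \<in> (parcs T)\<^sup>*"
proof -
  interpret T: pair_sym_digraph T using assms by (simp add: undirected_tree_def)
  have "parcs (mk_symmetric (with_proj T)) = parcs T"
    using T.arcs_symmetric by (auto simp: mk_symmetric_def)
  moreover have "a \<rightarrow>\<^sup>*\<^bsub>with_proj (mk_symmetric (with_proj T))\<^esub> b"
    using assms
    by (auto simp: undirected_tree_def connected_def strongly_connected_def mk_symmetric_def)
  ultimately show ?thesis
    using reachable_rtranclI by fastforce
qed

text \<open>A connected \<open>W\<close> grows vertex by vertex: some arc leaves it, and by
  uniqueness of the neighbour the new vertex brings exactly one edge, that is two arcs.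
  Connectedness of \<open>W\<close> is carried along because that uniqueness requires it.\<close>

lemma undirected_tree_subtree:
  assumes T: "undirected_tree T" and fin: "finite (pverts T)" and "k < card (pverts T)"
  shows "\<exists>W \<subseteq> pverts T. card W = Suc k \<and> card (parcs T \<inter> W \<times> W) = 2 * k \<and>
           (\<forall>a\<in>W. \<forall>b\<in>W. (a, b) \<in> (parcs T \<inter> W \<times> W)\<^sup>*)"
  using assms(3)
proof (induction k)
  case 0
  then obtain v where "v \<in> pverts T" by fastforce
  moreover have "parcs T \<inter> {v} \<times> {v} = {}"
    using undirected_tree_no_loop[OF T] by auto
  ultimately show ?case by (intro exI[of _ "{v}"]) auto
next
  case (Suc k)
  interpret T: pair_sym_digraph T using T by (simp add: undirected_tree_def)
  from Suc obtain W where W: "W \<subseteq> pverts T" "card W = Suc k"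
    and cardW: "card (parcs T \<inter> W \<times> W) = 2 * k"
    and conn: "\<And>a b. a \<in> W \<Longrightarrow> b \<in> W \<Longrightarrow> (a, b) \<in> (parcs T \<inter> W \<times> W)\<^sup>*"
    by fastforce
  have finW: "finite W" using W fin finite_subset by blast
  obtain a where a: "a \<in> W" using W(2) by fastforce
  obtain b where b: "b \<in> pverts T" "b \<notin> W" using W Suc.prems by (cases "W = pverts T") auto
  obtain x y where xy: "(x, y) \<in> parcs T" "x \<in> W" "y \<notin> W"
    using rtrancl_leaves_set[OF undirected_tree_reachable[OF T] a b(2)] a b W by blast
  let ?W = "insert y W"
  have yV: "y \<in> pverts T" using T.in_arcsD2 xy by blast
  have yx: "(y, x) \<in> parcs T" using T.arcs_symmetric xy by blast
  have *: "z = x" if "z \<in> W" "(z, y) \<in> parcs T \<or> (y, z) \<in> parcs T" for z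
    using undirected_tree_unique_neighbour[OF T W(1) xy(3) conn, of z x] that xy T.arcs_symmetric
    by blast
  have eq: "parcs T \<inter> ?W \<times> ?W = (parcs T \<inter> W \<times> W) \<union> {(x, y), (y, x)}"
    using * xy yx undirected_tree_no_loop[OF T, of y] by blast
  have "card (parcs T \<inter> ?W \<times> ?W) = card (parcs T \<inter> W \<times> W) + card {(x, y), (y, x)}"
    unfolding eq using xy(3) finW by (intro card_Un_disjoint) auto
  also have "card {(x, y), (y, x)} = 2"
    using xy(2,3) by (subst card_2_iff) blast
  finally have "card (parcs T \<inter> ?W \<times> ?W) = 2 * Suc k" using cardW by simp
  moreover have "(u, v) \<in> (parcs T \<inter> ?W \<times> ?W)\<^sup>*" if "u \<in> ?W" "v \<in> ?W" for u v
  proof -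
    have conn': "(u, v) \<in> (parcs T \<inter> ?W \<times> ?W)\<^sup>*" if "u \<in> W" "v \<in> W" for u v
      using rtrancl_mono[of "parcs T \<inter> W \<times> W" "parcs T \<inter> ?W \<times> ?W"] conn[OF that] by blast
    have "(u, x) \<in> (parcs T \<inter> ?W \<times> ?W)\<^sup>*"
      using that(1) conn'[OF _ xy(2)] yx xy(2) by auto
    moreover have "(x, v) \<in> (parcs T \<inter> ?W \<times> ?W)\<^sup>*"
      using that(2) conn'[OF xy(2)] xy by auto
    ultimately show ?thesis by (rule rtrancl_trans)
  qed
  moreover have "card ?W = Suc (Suc k)" "?W \<subseteq> pverts T"
    using W xy(3) finW yV by auto
  ultimately show ?case by blast
qed

text \<open>This is |E| = |V| - 1 doubled, each edge being a pair of opposite arcs; it comes from a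
  subtree on all the vertices.\<close>

lemma card_parcs_undirected_tree:
  assumes T: "undirected_tree T" and fin: "finite (pverts T)"
  shows "card (parcs T) + 2 = 2 * card (pverts T)"
proof -
  interpret T: pair_sym_digraph T using T by (simp add: undirected_tree_def)
  have ne: "pverts T \<noteq> {}"
    using T by (auto simp: undirected_tree_def connected_def strongly_connected_def mk_symmetric_def)
  then have pos: "card (pverts T) > 0" using fin by (simp add: card_gt_0_iff)
  with undirected_tree_subtree[OF T fin, of "card (pverts T) - 1"]
  obtain W where W: "W \<subseteq> pverts T" "card W = card (pverts T)"
    "card (parcs T \<inter> W \<times> W) = 2 * (card (pverts T) - 1)" by auto
  then have "W = pverts T" using fin card_subset_eq by blast
  moreover have "parcs T \<inter> pverts T \<times> pverts T = parcs T"
    using T.in_arcsD1 T.in_arcsD2 by auto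
  ultimately show ?thesis using W pos by simp
qed

text \<open>Sum over the trees; disjoint vertex sets force disjoint arc sets.\<close>

lemma card_parcs_disjoint_union_of_trees:
  assumes "disjoint_union_of_trees c G" and fin: "finite (pverts G)"
  shows "card (parcs G) + 2 * c = 2 * card (pverts G)"
proof -
  obtain F where F: "finite F" "card F = c" "\<forall>T\<in>F. undirected_tree T"
    and disj: "\<forall>T\<in>F. \<forall>T'\<in>F. T \<noteq> T' \<longrightarrow> pverts T \<inter> pverts T' = {}"
    and V: "pverts G = (\<Union>T\<in>F. pverts T)" and E: "parcs G = (\<Union>T\<in>F. parcs T)"
    using assms(1) unfolding disjoint_union_of_trees_def by (elim exE conjE) (rule that)
  have finT: "finite (pverts T)" if "T \<in> F" for T
    using that V by (intro finite_subset[OF _ fin]) auto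
  have sub: "parcs T \<subseteq> pverts T \<times> pverts T" if "T \<in> F" for T
  proof -
    interpret T: pair_sym_digraph T using F(3) that by (simp add: undirected_tree_def)
    show ?thesis using T.in_arcsD1 T.in_arcsD2 by auto
  qed
  have finE: "finite (parcs T)" if "T \<in> F" for T
    using sub[OF that] finT[OF that] finite_subset by blast
  have "parcs T \<inter> parcs T' = {}" if "T \<in> F" "T' \<in> F" "T \<noteq> T'" for T T'
    using sub[OF that(1)] sub[OF that(2)] disj that by blast
  then have "card (parcs G) = (\<Sum>T\<in>F. card (parcs T))"
    unfolding E using F(1) finE by (intro card_UN_disjoint) auto
  moreover have "card (pverts G) = (\<Sum>T\<in>F. card (pverts T))"
    unfolding V using F(1) finT disj by (intro card_UN_disjoint) auto
  moreover have "(\<Sum>T\<in>F. card (parcs T)) + (\<Sum>T\<in>F. 2) = (\<Sum>T\<in>F. 2 * card (pverts T))"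
    unfolding sum.distrib[symmetric]
    using card_parcs_undirected_tree F(3) finT by (intro sum.cong) auto
  ultimately show ?thesis
    using F(2) by (simp flip: sum_distrib_left)
qed


section \<open>Edge counts of extension graphs\<close>

lemma extension_graph_counts:
  assumes "finite A"
  shows "finite (pverts (extension_graph A S w))"
    and "card (pverts (extension_graph A S w)) = card (left_ext A S w) + card (right_ext A S w)"
    and "card (parcs (extension_graph A S w)) = 2 * card (bi_ext A S w)"
proof -
  have fin: "finite (left_ext A S w)" "finite (right_ext A S w)"
    using assms by (auto simp: left_ext_def right_ext_def)
  have "bi_ext A S w \<subseteq> A \<times> A" by (auto simp: bi_ext_def)
  then have finB: "finite (bi_ext A S w)" using assms finite_subset by blast
  show "finite (pverts (extension_graph A S w))"
    and "card (pverts (extension_graph A S w)) = card (left_ext A S w) + card (right_ext A S w)"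
    using fin by (auto simp: extension_graph_def card_Plus)
  \<comment> \<open>The two orientations of an edge; the tags \<open>Inl\<close> and
    \<open>Inr\<close> keep the two images disjoint.\<close>
  let ?f = "\<lambda>(a, b). (Inl a, Inr b) :: ('a + 'a) \<times> ('a + 'a)"
  let ?g = "\<lambda>(a, b). (Inr b, Inl a) :: ('a + 'a) \<times> ('a + 'a)"
  have "parcs (extension_graph A S w) = ?f ` bi_ext A S w \<union> ?g ` bi_ext A S w"
    by (auto simp: extension_graph_def)
  also have "card \<dots> = card (?f ` bi_ext A S w) + card (?g ` bi_ext A S w)"
    using finB by (intro card_Un_disjoint) auto
  also have "card (?f ` bi_ext A S w) = card (bi_ext A S w)"
    by (rule card_image) (auto simp: inj_on_def)
  also have "card (?g ` bi_ext A S w) = card (bi_ext A S w)"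
    by (rule card_image) (auto simp: inj_on_def)
  finally show "card (parcs (extension_graph A S w)) = 2 * card (bi_ext A S w)" by simp
qed

section \<open>The excess of a word\<close>

text \<open>Integer-valued, so that the subtraction is exact and excesses can be summed and
  cancelled.\<close>

definition excess :: "'a set \<Rightarrow> 'a list set \<Rightarrow> 'a list \<Rightarrow> int" where
  "excess A S w = int (card (right_ext A S w)) - 1"

definition left_prolongations :: "'a set \<Rightarrow> 'a list set \<Rightarrow> 'a list set \<Rightarrow> 'a list set" where
  "left_prolongations A S Y = (\<Union>y\<in>Y. (\<lambda>a. a # y) ` left_ext A S y)"

definition right_prolongations :: "'a set \<Rightarrow> 'a list set \<Rightarrow> 'a list set \<Rightarrow> 'a list set" where
  "right_prolongations A S Y = (\<Union>y\<in>Y. (\<lambda>a. y @ [a]) ` right_ext A S y)"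

locale tree_set_words =
  fixes A :: "'a set" and S :: "'a list set" and c :: nat
  assumes finA: "finite A" and tree_set: "tree_set A c S"
begin

lemma S_words: "w \<in> S \<Longrightarrow> set w \<subseteq> A"
  and singleton_in_S: "a \<in> A \<Longrightarrow> [a] \<in> S"
  and factor_in_S: "w \<in> S \<Longrightarrow> sublist v w \<Longrightarrow> v \<in> S"
  using tree_set by (auto simp: tree_set_def biextendable_def factorial_set_def)

lemma finite_S_length: "finite {y \<in> S. length y = k}"
  by (rule finite_subset[OF _ finite_lists_length_eq[OF finA, of k]]) (auto dest: S_words)

lemma finite_ext: "finite (left_ext A S w)" "finite (right_ext A S w)"
  using finA by (auto simp: left_ext_def right_ext_def)

lemma excess_nonneg:
  assumes "w \<in> S"
  shows "excess A S w \<ge> 0"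
proof -
  obtain a b where "a \<in> A" "b \<in> A" "a # w @ [b] \<in> S"
    using assms tree_set by (auto simp: tree_set_def biextendable_def bi_ext_def)
  then have "b \<in> right_ext A S w"
    using factor_in_S[of "a # w @ [b]" "w @ [b]"] by (simp add: right_ext_def sublist_Cons_right)
  then show ?thesis
    using finite_ext card_gt_0_iff[of "right_ext A S w"] by (auto simp: excess_def)
qed

text \<open>Group the pairs by their first letter \<open>a\<close>; factoriality makes
  \<open>a\<close> a left extension of \<open>w\<close>.\<close>

lemma card_bi_ext:
  "card (bi_ext A S w) = (\<Sum>a\<in>left_ext A S w. card (right_ext A S (a # w)))"
proof -
  have "bi_ext A S w = Sigma (left_ext A S w) (\<lambda>a. right_ext A S (a # w))"
    using factor_in_S[of "a # w @ [b]" "a # w" for a b]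
    by (auto simp: bi_ext_def left_ext_def right_ext_def sublist_Cons_right)
  then show ?thesis using finite_ext by simp
qed

lemma sum_excess_left_ext:
  "(\<Sum>a\<in>left_ext A S w. excess A S (a # w)) = int (card (bi_ext A S w)) - int (card (left_ext A S w))"
  by (simp add: excess_def sum_subtractf card_bi_ext)

text \<open>In a tree |B(w)| = |L(w)| + |R(w)| - 1, so subtracting |L(w)| leaves |R(w)| - 1.\<close>

lemma sum_excess_left_ext_nonempty:
  assumes "w \<in> S" "w \<noteq> []"
  shows "(\<Sum>a\<in>left_ext A S w. excess A S (a # w)) = excess A S w"
proof -
  have "undirected_tree (extension_graph A S w)"
    using assms tree_set by (simp add: tree_set_def)
  from card_parcs_undirected_tree[OF this] extension_graph_counts[OF finA, where S = S and w = w]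
  have "card (bi_ext A S w) + 1 = card (left_ext A S w) + card (right_ext A S w)"
    by simp
  then show ?thesis unfolding sum_excess_left_ext by (simp add: excess_def)
qed

text \<open>The same count for the empty word, where a forest of \<open>c\<close> trees loses
  \<open>c\<close> edges instead of one and R is all of \<open>A\<close>.\<close>

lemma sum_excess_letters:
  "(\<Sum>a\<in>left_ext A S []. excess A S [a]) = int (card A) - int c"
proof -
  have "disjoint_union_of_trees c (extension_graph A S [])"
    using tree_set by (simp add: tree_set_def)
  from card_parcs_disjoint_union_of_trees[OF this]
    extension_graph_counts[OF finA, where S = S and w = "[]"]
  have "card (bi_ext A S []) + c = card (left_ext A S []) + card (right_ext A S [])"
    by simp
  moreover have "right_ext A S [] = A"
    using singleton_in_S by (auto simp: right_ext_def)
  ultimately show ?thesis by (simp add: sum_excess_left_ext)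
qed

section \<open>Prolonging sets of words by one letter\<close>

lemma sum_left_prolongations:
  assumes "finite Y"
  shows "sum f (left_prolongations A S Y) = (\<Sum>y\<in>Y. \<Sum>a\<in>left_ext A S y. f (a # y))"
  unfolding left_prolongations_def using assms finite_ext
  by (subst sum.UNION_disjoint) (auto simp: sum.reindex inj_on_def)

lemma sum_excess_left_prolongations:
  assumes "finite Y" "Y \<subseteq> S" "[] \<notin> Y"
  shows "sum (excess A S) (left_prolongations A S Y) = sum (excess A S) Y"
  unfolding sum_left_prolongations[OF assms(1)]
proof (rule sum.cong)
  fix y assume "y \<in> Y"
  then show "(\<Sum>a\<in>left_ext A S y. excess A S (a # y)) = excess A S y"
    using assms by (intro sum_excess_left_ext_nonempty) auto
qed simp

text \<open>Each \<open>y\<close> has one more right extension than its excess, and a prolongation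
  determines \<open>y\<close>.\<close>

lemma card_right_prolongations:
  assumes "finite Y"
  shows "int (card (right_prolongations A S Y)) = int (card Y) + sum (excess A S) Y"
proof -
  have "card (right_prolongations A S Y) = (\<Sum>y\<in>Y. card ((\<lambda>a. y @ [a]) ` right_ext A S y))"
    unfolding right_prolongations_def using assms finite_ext by (intro card_UN_disjoint) auto
  also have "\<dots> = (\<Sum>y\<in>Y. card (right_ext A S y))"
    by (intro sum.cong card_image) (auto simp: inj_on_def)
  finally show ?thesis by (simp add: excess_def sum_subtractf)
qed

lemma left_prolongations_length:
  "left_prolongations A S {y \<in> S. length y = k} = {y \<in> S. length y = Suc k}"
proof (intro equalityI subsetI)
  fix z assume "z \<in> {y \<in> S. length y = Suc k}"
  then obtain a y where z: "z = a # y" "a # y \<in> S" "length y = k" by (cases z) auto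
  then have "y \<in> S" "a \<in> A" using factor_in_S[of z y] S_words[of z] by (auto simp: sublist_Cons_right)
  with z show "z \<in> left_prolongations A S {y \<in> S. length y = k}"
    by (auto simp: left_prolongations_def left_ext_def)
qed (auto simp: left_prolongations_def left_ext_def)

lemma sum_excess_length:
  assumes "[] \<in> S" "k > 0"
  shows "sum (excess A S) {y \<in> S. length y = k} = int (card A) - int c"
  using assms(2)
proof (induction k rule: nat_induct_non_zero)
  \<comment> \<open>Additivity is only available for nonempty words, so the induction starts from
    the letters.\<close>
  case 1
  have "{y \<in> S. length y = 0} = {[]}" using assms(1) by auto
  with left_prolongations_length[of 0] have "{y \<in> S. length y = 1} = left_prolongations A S {[]}"
    by simp
  then show ?case using sum_left_prolongations[of "{[]}" "excess A S"] sum_excess_letters by simp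
next
  case (Suc k)
  then show ?case
    using sum_excess_left_prolongations[of "{y \<in> S. length y = k}"] finite_S_length
    by (auto simp: left_prolongations_length)
qed

end

section \<open>Complete return words\<close>

definition avoiding :: "'a list set \<Rightarrow> 'a list set \<Rightarrow> nat \<Rightarrow> 'a list set" where
  "avoiding S X k = {y \<in> S. length y = k \<and> \<not> (\<exists>x\<in>X. sublist x y)}"

text \<open>For nonempty \<open>y\<close>, an occurrence in \<open>tl y\<close> is one that does not
  start at the first letter.\<close>

definition only_prefix :: "'a list set \<Rightarrow> 'a list set \<Rightarrow> nat \<Rightarrow> 'a list set" where
  "only_prefix S X k =
     {y \<in> S. length y = k \<and> (\<exists>x\<in>X. prefix x y) \<and> \<not> (\<exists>x\<in>X. sublist x (tl y))}"

text \<open>Equal lengths prevent a word of \<open>X\<close> from being a proper factor of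
  another.\<close>

locale return_words = tree_set_words +
  fixes X :: "'a list set" and n :: nat
  assumes recurrent: "recurrent A S"
    and X: "X \<subseteq> S" "X \<noteq> {}" "\<And>x. x \<in> X \<Longrightarrow> length x = n"
    and n: "n > 0"
begin

abbreviation V where "V \<equiv> avoiding S X"
abbreviation U where "U \<equiv> only_prefix S X"
abbreviation C where "C \<equiv> complete_return_words S X"

section \<open>Reading to the left until \<open>X\<close> occurs\<close>

lemma finite_V: "finite (V k)" and finite_U: "finite (U k)" and finite_C: "finite {y \<in> C. length y = k}"
  by (auto simp: avoiding_def only_prefix_def complete_return_words_def
      intro: finite_subset[OF _ finite_S_length[of k]])

lemma VU_disjoint: "V k \<inter> U k = {}"
  by (auto simp: avoiding_def only_prefix_def)

lemma U_lengthD: "u \<in> U k \<Longrightarrow> n \<le> k"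
  using X(3) prefix_length_le by (fastforce simp: only_prefix_def)

text \<open>A new first letter can create an occurrence of \<open>X\<close> only as a
  prefix.\<close>

lemma left_prolongation_V:
  assumes "y \<in> V k" "a # y \<in> S"
  shows "a # y \<in> V (Suc k) \<union> U (Suc k)"
  using assms by (auto simp: avoiding_def only_prefix_def sublist_Cons_right)

lemma left_prolongations_V: "left_prolongations A S (V k) = V (Suc k) \<union> U (Suc k)"
proof (intro equalityI subsetI)
  fix z assume z: "z \<in> V (Suc k) \<union> U (Suc k)"
  then obtain a y where "z = a # y" by (cases z) (auto simp: avoiding_def only_prefix_def)
  with z have "z = a # y" "a # y \<in> S" "y \<in> V k" "a \<in> A"
    using factor_in_S[of z y] S_words[of z]
    by (auto simp: avoiding_def only_prefix_def sublist_Cons_right)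
  then show "z \<in> left_prolongations A S (V k)"
    by (auto simp: left_prolongations_def left_ext_def)
qed (use left_prolongation_V in \<open>fastforce simp: left_prolongations_def left_ext_def\<close>)

text \<open>Additivity, split according to whether the new letter completes an occurrence;
  \<open>k > 0\<close> keeps \<open>[]\<close> out of \<open>V k\<close>.\<close>

lemma sum_excess_VU_Suc:
  assumes "k > 0"
  shows "sum (excess A S) (V (Suc k)) + sum (excess A S) (U (Suc k)) = sum (excess A S) (V k)"
  using sum_excess_left_prolongations[of "V k"] finite_V finite_U VU_disjoint[of "Suc k"] assms
  by (simp add: left_prolongations_V sum.union_disjoint) (auto simp: avoiding_def)

section \<open>Complete return words as leaves of the forest\<close>

lemma internal_factor_iff:
  assumes "x \<in> X"
  shows "internal_factor x y \<longleftrightarrow> sublist x (tl (butlast y))"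
proof
  assume "internal_factor x y"
  then obtain u v where uv: "u \<noteq> []" "v \<noteq> []" "y = u @ x @ v" by (auto simp: internal_factor_def)
  then have "tl (butlast y) = tl u @ x @ butlast v" by (simp add: butlast_append)
  then show "sublist x (tl (butlast y))" by simp
next
  assume "sublist x (tl (butlast y))"
  then obtain u v where uv: "tl (butlast y) = u @ x @ v" by (auto simp: sublist_def)
  \<comment> \<open>An empty \<open>x\<close> would be a factor of the truncated word even if
    \<open>y\<close> is too short to have internal factors.\<close>
  moreover have "x \<noteq> []" using X(3) assms n by auto
  ultimately have ne: "butlast y \<noteq> []" by (cases "butlast y") auto
  then have "y \<noteq> []" by auto
  then have "y = butlast y @ [last y]" by simp
  also have "butlast y = (hd (butlast y) # u) @ x @ v" using uv ne by (cases "butlast y") auto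
  finally have "y = (hd (butlast y) # u) @ x @ (v @ [last y])" by simp
  then show "internal_factor x y" unfolding internal_factor_def by blast
qed

text \<open>Splitting off the last letter exposes the parent \<open>y\<close> in the forest: the
  letter \<open>b\<close> completes the second occurrence. Using \<open>tl y\<close> in the suffix
  condition makes the suffix proper.\<close>

lemma C_conv:
  "y @ [b] \<in> C \<longleftrightarrow> y @ [b] \<in> S \<and> (\<exists>x\<in>X. prefix x y) \<and> (\<exists>x\<in>X. suffix x (tl y @ [b])) \<and>
     \<not> (\<exists>x\<in>X. sublist x (tl y))"
proof -
  have pre: "strict_prefix x (y @ [b]) \<longleftrightarrow> prefix x y" for x
    by (auto simp: strict_prefix_def)
  have "strict_suffix x (y @ [b]) \<longleftrightarrow> suffix x (tl y @ [b])" if "y \<noteq> []" for x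
    using that by (cases y) (auto simp: strict_suffix_def suffix_Cons dest: suffix_length_le)
  moreover have "internal_factor x (y @ [b]) \<longleftrightarrow> sublist x (tl y)" if "x \<in> X" for x
    using internal_factor_iff[OF that, of "y @ [b]"] by simp
  moreover have "y \<noteq> []" if "\<exists>x\<in>X. prefix x y"
    using that X(3) n by fastforce
  ultimately show ?thesis
    by (cases "\<exists>x\<in>X. prefix x y") (simp_all add: complete_return_words_def pre)
qed

lemma U_snoc_conv:
  assumes "n \<le> k" "length y = k"
  shows "y @ [b] \<in> U (Suc k) \<longleftrightarrow> y @ [b] \<in> S \<and> (\<exists>x\<in>X. prefix x y) \<and>
     \<not> (\<exists>x\<in>X. suffix x (tl y @ [b])) \<and> \<not> (\<exists>x\<in>X. sublist x (tl y))"
proof -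
  have "y \<noteq> []" using assms n by auto
  moreover have "prefix x (y @ [b]) \<longleftrightarrow> prefix x y" if "x \<in> X" for x
    using X(3)[OF that] assms by auto
  ultimately show ?thesis
    using assms by (auto simp: only_prefix_def sublist_snoc)
qed

lemma right_prolongation_U:
  assumes "y \<in> U k" "y @ [b] \<in> S"
  shows "y @ [b] \<in> U (Suc k) \<union> {z \<in> C. length z = Suc k}"
  using assms U_lengthD[OF assms(1)] U_snoc_conv[of k y b] C_conv[of y b]
  by (auto simp: only_prefix_def)

text \<open>A child of an inner node is an inner node or a leaf, and conversely;
  \<open>n \<le> k\<close> means that no new roots appear at the next level.\<close>

lemma right_prolongations_U:
  assumes "n \<le> k"
  shows "right_prolongations A S (U k) = U (Suc k) \<union> {z \<in> C. length z = Suc k}"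
proof (intro equalityI subsetI)
  fix z assume z: "z \<in> U (Suc k) \<union> {z \<in> C. length z = Suc k}"
  then obtain y b where yb: "z = y @ [b]"
    by (cases z rule: rev_cases) (auto simp: only_prefix_def)
  have len: "length y = k" using z yb by (auto simp: only_prefix_def)
  have "z \<in> S" using z by (auto simp: only_prefix_def complete_return_words_def)
  moreover from this have "y \<in> S" "b \<in> A"
    using yb factor_in_S[of z y] S_words[of z] by auto
  ultimately have "y @ [b] \<in> S" "y \<in> U k" "b \<in> A"
    using z yb len U_snoc_conv[OF assms len, of b] C_conv[of y b] by (auto simp: only_prefix_def)
  then show "z \<in> right_prolongations A S (U k)"
    using yb by (auto simp: right_prolongations_def right_ext_def)
qed (use right_prolongation_U in \<open>fastforce simp: right_prolongations_def right_ext_def\<close>)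

lemma card_U_Suc:
  assumes "n \<le> k"
  shows "int (card (U (Suc k))) + int (card {z \<in> C. length z = Suc k}) =
    int (card (U k)) + sum (excess A S) (U k)"
proof -
  have "U (Suc k) \<inter> {z \<in> C. length z = Suc k} = {}"
  proof (intro equals0I)
    fix z assume z: "z \<in> U (Suc k) \<inter> {z \<in> C. length z = Suc k}"
    then obtain y b where "z = y @ [b]"
      by (cases z rule: rev_cases) (auto simp: only_prefix_def)
    with z show False
      using U_snoc_conv[OF assms, of y b] C_conv[of y b] by (auto simp: only_prefix_def)
  qed
  then have "card (right_prolongations A S (U k)) =
      card (U (Suc k)) + card {z \<in> C. length z = Suc k}"
    unfolding right_prolongations_U[OF assms]
    using finite_U finite_C by (intro card_Un_disjoint) auto
  with card_right_prolongations[OF finite_U, of k] show ?thesis by simp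
qed

section \<open>The counting identity\<close>

lemma C_length:
  assumes "z \<in> C"
  shows "n < length z"
proof -
  obtain x where "x \<in> X" "strict_prefix x z" using assms by (auto simp: complete_return_words_def)
  then show ?thesis using X(3) prefix_length_less by fastforce
qed

lemma Nil_in_S: "[] \<in> S"
proof -
  obtain x where "x \<in> X" using X by auto
  then show ?thesis using X factor_in_S[of x "[]"] by auto
qed

lemma U_n: "U n = X"
proof -
  have "x = y" if "x \<in> X" "length y = n" "prefix x y" for x y
    using that X(3) by (metis prefix_length_prefix prefix_order.eq_iff prefix_order.refl order_refl)
  moreover have "\<not> sublist x (tl y)" if "x \<in> X" "length y = n" for x y
    using sublist_length_le[of x "tl y"] that X(3) n by (cases y) auto
  ultimately show ?thesis
    using X by (auto simp: only_prefix_def)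
qed

lemma V_U_n: "V n \<union> U n = {y \<in> S. length y = n}"
proof -
  have "x = y" if "x \<in> X" "length y = n" "sublist x y" for x y
    using that X(3)[OF that(1)] by (auto simp: sublist_def)
  then show ?thesis using X unfolding U_n by (auto simp: avoiding_def)
qed

text \<open>In passing from \<open>k\<close> to \<open>Suc k\<close>, the words of \<open>U k\<close> are extended to the right
  and those of \<open>V k\<close> to the left.\<close>

lemma counting_invariant:
  assumes "n \<le> k"
  shows "int (card (U k)) + int (card {z \<in> C. length z \<le> k}) +
    sum (excess A S) (U k) + sum (excess A S) (V k) = int (card X) + int (card A) - int c"
  using assms
proof (induction k rule: dec_induct)
  case base
  have "{z \<in> C. length z \<le> n} = {}" using C_length by fastforce
  then have "card {z \<in> C. length z \<le> n} = 0" by (metis card.empty)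
  moreover have "sum (excess A S) (V n) + sum (excess A S) (U n) = int (card A) - int c"
    using sum_excess_length[OF Nil_in_S n] V_U_n VU_disjoint[of n] finite_V finite_U
    by (metis sum.union_disjoint)
  ultimately show ?case by (simp add: U_n)
next
  case (step k)
  have "{z \<in> C. length z \<le> Suc k} = {z \<in> C. length z \<le> k} \<union> {z \<in> C. length z = Suc k}"
    by auto
  moreover have "finite {z \<in> C. length z \<le> k}"
  proof -
    have "{z \<in> C. length z \<le> k} = (\<Union>i\<le>k. {z \<in> C. length z = i})" by auto
    then show ?thesis using finite_C by simp
  qed
  ultimately have "card {z \<in> C. length z \<le> Suc k} =
      card {z \<in> C. length z \<le> k} + card {z \<in> C. length z = Suc k}"
    using finite_C by (simp only:) (intro card_Un_disjoint; auto)
  \<comment> \<open>The excess of \<open>U k\<close> turns into new nodes and leaves, while the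
    excess lost by \<open>V k\<close> is that of \<open>U (Suc k)\<close>; the total is
    unchanged.\<close>
  then show ?case
    using step card_U_Suc[of k] sum_excess_VU_Suc[of k] n by simp
qed

section \<open>Finiteness and the exact count\<close>

lemma finite_complete_return_words: "finite C"
proof (rule ccontr)
  assume "infinite C"
  \<comment> \<open>One element more than the bound which the invariant gives once the nonnegative
    terms are dropped.\<close>
  then obtain G where G: "G \<subseteq> C" "finite G" "card G = Suc (card X + card A)"
    using infinite_arbitrarily_large[of C "Suc (card X + card A)"] by blast
  define k where "k = n + Max (insert 0 (length ` G))"
  have "length z \<le> k" if "z \<in> G" for z
    using that G by (auto simp: k_def intro: trans_le_add2)
  then have sub: "G \<subseteq> {z \<in> C. length z \<le> k}" using G by auto
  have "{z \<in> C. length z \<le> k} = (\<Union>i\<le>k. {z \<in> C. length z = i})" by auto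
  then have "finite {z \<in> C. length z \<le> k}" using finite_C by simp
  then have "card G \<le> card {z \<in> C. length z \<le> k}" using sub card_mono by blast
  moreover have "sum (excess A S) (U k) \<ge> 0" "sum (excess A S) (V k) \<ge> 0"
    using excess_nonneg by (auto intro!: sum_nonneg simp: only_prefix_def avoiding_def)
  ultimately show False
    using counting_invariant[of k] G(3) by (simp add: k_def)
qed

text \<open>Append the letters of \<open>t\<close> one by one: the word stays an inner node until
  the first new occurrence of \<open>X\<close>, where it becomes a complete return word.\<close>

lemma U_extends_to_C:
  assumes "u \<in> U k" "u @ t \<in> S" "x \<in> X" "sublist x (tl (u @ t))"
  shows "\<exists>z\<in>C. k < length z"
  using assms
proof (induction t arbitrary: u k)
  case Nil
  then show ?case by (auto simp: only_prefix_def)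
next
  case (Cons b t)
  have "u @ [b] \<in> S" using Cons.prems(2) factor_in_S[of "u @ b # t" "u @ [b]"]
    by (metis append.assoc append_Cons append_Nil sublist_append_rightI)
  from right_prolongation_U[OF Cons.prems(1) this] show ?case
  proof
    assume "u @ [b] \<in> U (Suc k)"
    from Cons.IH[OF this] Cons.prems show ?thesis by (auto intro: Suc_lessD)
  next
    assume "u @ [b] \<in> {z \<in> C. length z = Suc k}"
    then show ?thesis by (intro bexI[of _ "u @ [b]"]) auto
  qed
qed

text \<open>By recurrence some word of \<open>X\<close> occurs again to the right of
  \<open>u\<close>.\<close>

lemma U_short:
  assumes "u \<in> U k"
  shows "\<exists>z\<in>C. k < length z"
proof -
  obtain x where x: "x \<in> X" using X by auto
  have "u \<in> S" using assms by (simp add: only_prefix_def)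
  with x X(1) obtain v where v: "u @ v @ x \<in> S"
    using recurrent unfolding recurrent_def by blast
  have "u \<noteq> []" using U_lengthD[OF assms] assms n by (auto simp: only_prefix_def)
  then have "tl (u @ v @ x) = (tl u @ v) @ x" by simp
  then have "sublist x (tl (u @ v @ x))" by (metis sublist_append_leftI)
  with U_extends_to_C[OF assms v x] show ?thesis by blast
qed

text \<open>The mirror argument: the letters of \<open>t\<close> are prepended from its end until
  \<open>X\<close> first occurs, necessarily as a prefix.\<close>

lemma V_extends_to_U:
  assumes "v \<in> V k" "t @ v \<in> S" "x \<in> X" "sublist x (t @ v)"
  shows "\<exists>j>k. U j \<noteq> {}"
  using assms
proof (induction t arbitrary: v k rule: rev_induct)
  case Nil
  then show ?case by (auto simp: avoiding_def)
next
  case (snoc a t)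
  have "a # v \<in> S" using snoc.prems(2) factor_in_S[of "t @ a # v" "a # v"] by simp
  from left_prolongation_V[OF snoc.prems(1) this] show ?case
  proof
    assume "a # v \<in> V (Suc k)"
    from snoc.IH[OF this] snoc.prems show ?thesis by (auto intro: Suc_lessD)
  qed auto
qed

lemma V_short:
  assumes "v \<in> V k"
  shows "\<exists>z\<in>C. k < length z"
proof -
  obtain x where x: "x \<in> X" using X by auto
  have "v \<in> S" using assms by (simp add: avoiding_def)
  with x X(1) obtain y where "x @ y @ v \<in> S"
    using recurrent unfolding recurrent_def by blast
  then obtain j where "j > k" "U j \<noteq> {}"
    using V_extends_to_U[OF assms, of "x @ y" x] x by auto
  then show ?thesis using U_short by fastforce
qed

text \<open>Beyond the longest complete return word both \<open>U k\<close> and \<open>V k\<close>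
  are empty, so only \<open>card C\<close> survives in the invariant.\<close>

theorem card_complete_return_words: "card C + c = card X + card A"
proof -
  \<comment> \<open>Adding \<open>n\<close> gives \<open>n \<le> k\<close>, and
    \<open>insert 0\<close> covers an empty \<open>C\<close>.\<close>
  define k where "k = n + Max (insert 0 (length ` C))"
  have le: "length z \<le> k" if "z \<in> C" for z
    using that finite_complete_return_words by (auto simp: k_def intro: trans_le_add2)
  then have "U k = {}" "V k = {}" using U_short V_short by fastforce+
  moreover have "{z \<in> C. length z \<le> k} = C" using le by auto
  ultimately show ?thesis using counting_invariant[of k] by (simp add: k_def)
qed

end

theorem theorem6p9:
  fixes A :: "'a set" and \<theta> :: "'a \<Rightarrow> 'a" and S :: "'a list set" and w :: "'a list"
  assumes "finite A"
    and "involution_on A \<theta>"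
    and "specular A \<theta> S"
    and "recurrent A S"
    and "w \<in> S"
    and "w \<noteq> inv_word \<theta> w"
  shows "card (complete_return_words S {w, inv_word \<theta> w}) = card A"
proof -
  \<comment> \<open>\<open>w\<close> is nonempty because \<open>[]\<close> is its own inverse, and
    inversion preserves length.\<close>
  interpret return_words A S 2 "{w, inv_word \<theta> w}" "length w"
    using assms by unfold_locales (auto simp: specular_def laminary_def inv_word_def)
  \<comment> \<open>As \<open>w\<close> differs from its inverse, \<open>X\<close> has two elements,
    which cancel the characteristic 2.\<close>
  show ?thesis using card_complete_return_words assms(6) by simp
qed

end
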